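(* Let $B$ be a bouquet of $n$ circles and let $\ell:(H,v)\to B$ be an immersion of a finite connected based graph that is highly inert. Then $\ell:(H,v)\to B$ is inert.
   Context: Graphs: a graph $\Gamma$ is a $1$-dimensional CW-complex with vertex set $\Gamma^0$ and edge set $\Gamma^1$ (open $1$-cells), each edge oriented from an origin to a terminus. A morphism sends vertices to vertices and edges homeomorphically to edges (compatibly with origin and terminus); an immersion is a locally injective morphism. A bouquet of $n$ circles is a graph with one vertex and $n$ edges. The link $\mathrm{link}(v)$ of a vertex is the set of length-$1$ paths (edges traversed in either direction) starting at $v$; a loop at $v$ contributes two elements. $\deg(v)=|\mathrm{link}(v)|$, and $v$ is branching if $\deg(v)\ge3$; for a vertex set $S$, $S^*$ is the set of branching vertices in $S$. Inert sets: for an immersion $\ell:H\to B$, a set $S\subset H^0$ is inert if for every $v\in S^*$, $\sum_{w\in S^*\setminus\{v\}}|\ell(\mathrm{link}(v))\cap\ell(\mathrm{link}(w))|\le2$, where $\ell(\mathrm{link}(v))$ is a subset of the link of the vertex of $B$. An immersion of graphs $\phi:H\to K$ is highly inert if for every $w\in K^0$ the set $\phi^{-1}(w)\subset H^0$ is inert. In particular $\ell:H\to B$ is highly inert iff $H^0$ is inert. Inert immersions: a finite connected graph has $\mathrm{rank}(\Gamma)=1-|\Gamma^0|+|\Gamma^1|$. For immersions $\ell_H:(H,v)\to B$ and $\ell_K:(K,w)\to B$, the fiber product $H\otimes_BK$ has vertex set $H^0\times K^0$ and edge set $\{(e_1,e_2)\in H^1\times K^1:\ell_H(e_1)=\ell_K(e_2)\}$.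 The based immersion $(H,v)\to B$ is inert if for every immersion $(K,w)\to B$ of a finite connected based graph, the component of $H\otimes_BK$ containing $(v,w)$ has rank at most $\mathrm{rank}(K)$. *)

theory Defs
  imports Graph_Theory.Digraph_Component
begin

text \<open>
  A graph with oriented edges is a \<^locale>\<open>wf_digraph\<close> of the AFP entry \<open>Graph_Theory\<close>: loops and
  parallel edges are allowed, \<open>tail\<close> is the origin and \<open>head\<close> the terminus of an edge.
  Connectedness is that of the underlying undirected graph
  (\<^const>\<open>Digraph_Component.connected\<close>, which also requires a vertex). That constant is always
  written qualified, since the topological one has the same base name.
\<close>

text \<open>
  Length-1 paths starting at \<open>v\<close>: left summands traverse an edge from origin to terminus, right
  summands from terminus to origin. A loop at \<open>v\<close> thus contributes two elements.
\<close>
definition link :: "('a, 'e) pre_digraph \<Rightarrow> 'a \<Rightarrow> ('e + 'e) set" where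
  "link G v = out_arcs G v <+> in_arcs G v"

text \<open>As \<open>card\<close> is used, this is the degree only at vertices with finite link.\<close>
definition link_degree :: "('a, 'e) pre_digraph \<Rightarrow> 'a \<Rightarrow> nat" where
  "link_degree G v = card (link G v)"

definition branching :: "('a, 'e) pre_digraph \<Rightarrow> 'a set \<Rightarrow> 'a set" where
  "branching G S = {v \<in> S. link_degree G v \<ge> 3}"

record ('a, 'e, 'b, 'f) graph_map =
  on_verts :: "'a \<Rightarrow> 'b"
  on_arcs :: "'e \<Rightarrow> 'f"

definition graph_morphism ::
    "('a, 'e, 'b, 'f) graph_map \<Rightarrow> ('a, 'e) pre_digraph \<Rightarrow> ('b, 'f) pre_digraph \<Rightarrow> bool" where
  "graph_morphism f G G' \<longleftrightarrow> wf_digraph G \<and> wf_digraph G' \<and>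
     (\<forall>v \<in> verts G. on_verts f v \<in> verts G') \<and>
     (\<forall>e \<in> arcs G. on_arcs f e \<in> arcs G' \<and>
        tail G' (on_arcs f e) = on_verts f (tail G e) \<and>
        head G' (on_arcs f e) = on_verts f (head G e))"

definition on_link :: "('a, 'e, 'b, 'f) graph_map \<Rightarrow> 'e + 'e \<Rightarrow> 'f + 'f" where
  "on_link f = map_sum (on_arcs f) (on_arcs f)"

text \<open>
  Local injectivity of a morphism is automatic in the interior of edges; at a vertex it means
  injectivity on the link.
\<close>
definition immersion ::
    "('a, 'e, 'b, 'f) graph_map \<Rightarrow> ('a, 'e) pre_digraph \<Rightarrow> ('b, 'f) pre_digraph \<Rightarrow> bool" where
  "immersion f G G' \<longleftrightarrow> graph_morphism f G G' \<and> (\<forall>v \<in> verts G. inj_on (on_link f) (link G v))"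

definition bouquet :: "nat \<Rightarrow> ('b, 'f) pre_digraph \<Rightarrow> bool" where
  "bouquet n B \<longleftrightarrow> wf_digraph B \<and> card (verts B) = 1 \<and> finite (arcs B) \<and> card (arcs B) = n"

text \<open>Meant for finite \<open>H\<close>, so that the sum is a finite one.\<close>
definition inert_set ::
    "('a, 'e, 'b, 'f) graph_map \<Rightarrow> ('a, 'e) pre_digraph \<Rightarrow> 'a set \<Rightarrow> bool" where
  "inert_set l H S \<longleftrightarrow> S \<subseteq> verts H \<and>
     (\<forall>v \<in> branching H S.
        (\<Sum>w \<in> branching H S - {v}. card (on_link l ` link H v \<inter> on_link l ` link H w)) \<le> 2)"

text \<open>
  Here \<open>l\<close> is the immersion from \<open>H\<close> to the base graph with respect to which links are compared;
  \<open>p\<close> is the immersion from \<open>H\<close> to \<open>K\<close> said to be highly inert. For \<open>p = l\<close> one obtains high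
  inertness of \<open>l\<close> itself.
\<close>
definition highly_inert ::
    "('a, 'e, 'b, 'f) graph_map \<Rightarrow> ('a, 'e, 'c, 'g) graph_map \<Rightarrow>
     ('a, 'e) pre_digraph \<Rightarrow> ('c, 'g) pre_digraph \<Rightarrow> bool" where
  "highly_inert l p H K \<longleftrightarrow> (\<forall>w \<in> verts K. inert_set l H {v \<in> verts H. on_verts p v = w})"

definition graph_rank :: "('a, 'e) pre_digraph \<Rightarrow> int" where
  "graph_rank G = 1 - int (card (verts G)) + int (card (arcs G))"

text \<open>All pairs of vertices are taken, because the common target is meant to have one vertex.\<close>
definition fiber_product ::
    "('a, 'e, 'b, 'f) graph_map \<Rightarrow> ('a, 'e) pre_digraph \<Rightarrow>
     ('c, 'g, 'b, 'f) graph_map \<Rightarrow> ('c, 'g) pre_digraph \<Rightarrow> ('a \<times> 'c, 'e \<times> 'g) pre_digraph" where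
  "fiber_product lH H lK K =
     \<lparr> verts = verts H \<times> verts K,
       arcs = {(e1, e2) \<in> arcs H \<times> arcs K. on_arcs lH e1 = on_arcs lK e2},
       tail = map_prod (tail H) (tail K),
       head = map_prod (head H) (head K) \<rparr>"

text \<open>
  The connected component of \<open>u\<close>, for the underlying undirected graph. Symmetrization serves only
  to find its vertices; all edges of \<open>G\<close> between them are kept, with multiplicity.
\<close>
definition component :: "('a, 'e) pre_digraph \<Rightarrow> 'a \<Rightarrow> ('a, 'e) pre_digraph" where
  "component G u = G \<restriction> {x. reachable (with_proj (mk_symmetric G)) u x}"

text \<open>
  A definition cannot quantify over the types of vertices and edges of the test graph \<open>K\<close>, so
  these types are parameters; to be inert is to satisfy the condition for all of them.
\<close>
definition inert_immersion ::
    "'c itself \<Rightarrow> 'g itself \<Rightarrow> ('a, 'e, 'b, 'f) graph_map \<Rightarrow>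
     ('a, 'e) pre_digraph \<Rightarrow> 'a \<Rightarrow> ('b, 'f) pre_digraph \<Rightarrow> bool" where
  "inert_immersion TYPE('c) TYPE('g) lH H v B \<longleftrightarrow>
     (\<forall>(K :: ('c, 'g) pre_digraph) w lK.
        fin_digraph K \<and> Digraph_Component.connected K \<and> w \<in> verts K \<and> immersion lK K B \<longrightarrow>
        graph_rank (component (fiber_product lH H lK K) (v, w)) \<le> graph_rank K)"

end

theory Submission
  imports Defs
begin

text \<open>
  For a graph with vertex degrees \<open>d\<close>, twice its rank minus two is the sum of \<open>d - 2\<close> over the
  vertices. Pruning leaves off the component of the fiber product yields a subgraph \<open>D\<close> of at least
  the same rank (unless that rank is at most zero) in which all degrees are at least two. Let \<open>K'\<close>
  be the projection of \<open>D\<close> to \<open>K\<close>. The links of the vertices of \<open>D\<close> over a vertex \<open>k\<close> of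
  \<open>K'\<close> embed into the link of \<open>k\<close> in \<open>K'\<close>; by inertness they overlap so little that the sum of
  their excesses over two is at most the excess of the degree of \<open>k\<close>. Hence the rank of \<open>D\<close>
  is at most that of \<open>K'\<close>, which is at most that of \<open>K\<close> because \<open>K\<close> is connected.
\<close>

section \<open>Families of sets with small overlaps\<close>

text \<open>Let \<open>b i\<close> be the part of \<open>a i\<close> outside all the other sets. The
  overlap bound leaves it at least \<open>card (a i) - m\<close> elements. One whole set
  \<open>a i0\<close> and the parts \<open>b i\<close> of the others are pairwise disjoint in
  \<open>L\<close>, so their sizes add up to at most \<open>card L\<close>; subtracting
  \<open>m\<close> once, for \<open>i0\<close>, gives the claim.\<close>

lemma sum_card_excess_le:
  fixes a :: "'i \<Rightarrow> 'x set"
  assumes "finite T" "T \<noteq> {}" "finite L" "\<And>i. i \<in> T \<Longrightarrow> a i \<subseteq> L"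
    and overlap: "\<And>i. i \<in> T \<Longrightarrow> (\<Sum>j \<in> T - {i}. card (a i \<inter> a j)) \<le> m"
  shows "(\<Sum>i\<in>T. int (card (a i)) - int m) \<le> int (card L) - int m"
proof -
  define b where "b i = a i - (\<Union>j \<in> T - {i}. a j)" for i
  obtain i0 where i0: "i0 \<in> T" using assms(2) by blast
  have fin: "finite (a i)" if "i \<in> T" for i
    using that assms(3,4) finite_subset by blast
  have fin_b: "finite (b i)" if "i \<in> T" for i
    using fin[OF that] by (simp add: b_def)
  have b_ge: "int (card (a i)) - int m \<le> int (card (b i))" if i: "i \<in> T" for i
  proof -
    have "a i = b i \<union> (\<Union>j \<in> T - {i}. a i \<inter> a j)" unfolding b_def by blast
    then have "card (a i) \<le> card (b i) + card (\<Union>j \<in> T - {i}. a i \<inter> a j)"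
      by (metis card_Un_le)
    also have "card (\<Union>j \<in> T - {i}. a i \<inter> a j) \<le> (\<Sum>j \<in> T - {i}. card (a i \<inter> a j))"
      using assms(1) by (intro card_UN_le) simp
    finally show ?thesis using overlap[OF i] by linarith
  qed
  have "card (a i0) + (\<Sum>i \<in> T - {i0}. card (b i)) = card (a i0) + card (\<Union>i \<in> T - {i0}. b i)"
    using assms(1) fin_b by (subst card_UN_disjoint) (auto simp: b_def)
  also have "\<dots> = card (a i0 \<union> (\<Union>i \<in> T - {i0}. b i))"
    using i0 assms(1) fin fin_b by (subst card_Un_disjoint) (auto simp: b_def)
  also have "\<dots> \<le> card L"
    using i0 assms(3,4) by (intro card_mono) (auto simp: b_def)
  finally have "int (card (a i0)) + (\<Sum>i \<in> T - {i0}. int (card (b i))) \<le> int (card L)"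
    by (simp flip: of_nat_sum of_nat_add)
  moreover have "(\<Sum>i \<in> T - {i0}. int (card (a i)) - int m) \<le> (\<Sum>i \<in> T - {i0}. int (card (b i)))"
    using b_ge by (intro sum_mono) auto
  moreover have "(\<Sum>i\<in>T. int (card (a i)) - int m)
      = int (card (a i0)) - int m + (\<Sum>i \<in> T - {i0}. int (card (a i)) - int m)"
    using assms(1) i0 by (rule sum.remove)
  ultimately show ?thesis by linarith
qed

section \<open>Degrees and ranks\<close>

lemma finite_link: "fin_digraph G \<Longrightarrow> finite (link G x)"
  by (simp add: link_def fin_digraph.finite_in_arcs fin_digraph.finite_out_arcs)

lemma link_degree_conv:
  assumes "fin_digraph G"
  shows "link_degree G x = card (out_arcs G x) + card (in_arcs G x)"
  using assms unfolding link_degree_def link_def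
  by (simp add: card_Plus fin_digraph.finite_in_arcs fin_digraph.finite_out_arcs)

lemma link_subgraph_mono: "subgraph G' G \<Longrightarrow> link G' x \<subseteq> link G x"
  by (auto simp: link_def subgraph_def compatible_def in_arcs_def out_arcs_def)

lemma sum_link_degree:
  assumes "fin_digraph G"
  shows "(\<Sum>x\<in>verts G. link_degree G x) = 2 * card (arcs G)"
proof -
  interpret fin_digraph G by fact
  have "(\<Sum>x\<in>verts G. card (out_arcs G x)) = card (arcs G)"
    \<comment> \<open>Counts the edges by their origins.\<close>
    using sum.group[of "arcs G" "verts G" "tail G" "\<lambda>_. 1::nat"]
    by (simp add: out_arcs_def image_subset_iff)
  moreover have "(\<Sum>x\<in>verts G. card (in_arcs G x)) = card (arcs G)"
    using sum.group[of "arcs G" "verts G" "head G" "\<lambda>_. 1::nat"]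
    by (simp add: in_arcs_def image_subset_iff)
  ultimately show ?thesis by (simp add: link_degree_conv[OF assms] sum.distrib)
qed

text \<open>The handshake identity turns the rank into a sum of local terms, which can then be
  compared fiber by fiber. Doubling avoids fractions.\<close>

lemma graph_rank_conv_degree:
  assumes "fin_digraph G"
  shows "2 * graph_rank G = 2 + (\<Sum>x\<in>verts G. int (link_degree G x) - 2)"
proof -
  have "(\<Sum>x\<in>verts G. int (link_degree G x)) = 2 * int (card (arcs G))"
    using sum_link_degree[OF assms] by (metis of_nat_sum of_nat_mult of_nat_numeral)
  then show ?thesis by (simp add: graph_rank_def sum_subtractf)
qed

text \<open>At most one edge disappears together with the vertex, so the rank cannot drop; it rises
  if the vertex is isolated.\<close>

lemma graph_rank_le_del_vert:
  assumes "fin_digraph G" "x \<in> verts G" "link_degree G x \<le> 1"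
  shows "graph_rank G \<le> graph_rank (pre_digraph.del_vert G x)"
proof -
  interpret fin_digraph G by fact
  have "arcs (del_vert x) \<union> (out_arcs G x \<union> in_arcs G x) = arcs G"
    by (auto simp: del_vert_simps)
  then have "card (arcs G) \<le> card (arcs (del_vert x)) + card (out_arcs G x \<union> in_arcs G x)"
    using card_Un_le[of "arcs (del_vert x)" "out_arcs G x \<union> in_arcs G x"] by (simp only:)
  also have "card (out_arcs G x \<union> in_arcs G x) \<le> 1"
    using card_Un_le[of "out_arcs G x" "in_arcs G x"] assms(3)
    by (simp add: link_degree_conv[OF assms(1)])
  finally have "card (arcs G) \<le> card (arcs (del_vert x)) + 1" by simp
  moreover have "card (verts G) = Suc (card (verts (del_vert x)))"
    unfolding verts_del_vert using assms(2) by (intro card.remove) simp_all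
  ultimately show ?thesis by (simp add: graph_rank_def)
qed

lemma graph_rank_singleton_le:
  assumes "fin_digraph G" "verts G = {x}" "link_degree G x \<le> 1"
  shows "graph_rank G \<le> 0"
  using sum_link_degree[OF assms(1)] assms(2,3) by (simp add: graph_rank_def)

text \<open>Vertices of degree at most 1 are deleted until none is left; no deletion lowers the
  rank.\<close>

lemma exists_min_degree_2_subgraph:
  assumes "fin_digraph G" "verts G \<noteq> {}" "graph_rank G > 0"
  shows "\<exists>D. subgraph D G \<and> verts D \<noteq> {} \<and> (\<forall>x \<in> verts D. 2 \<le> link_degree D x)
    \<and> graph_rank G \<le> graph_rank D"
  using assms
proof (induction "card (verts G)" arbitrary: G rule: less_induct)
  case less
  interpret fin_digraph G by (rule less.prems)
  show ?case
  proof (cases "\<forall>x \<in> verts G. 2 \<le> link_degree G x")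
    case True
    then show ?thesis using less.prems subgraph_refl by blast
  next
    case False
    then obtain x where x: "x \<in> verts G" "link_degree G x \<le> 1" by force
    let ?G = "del_vert x"
    \<comment> \<open>The empty graph has formal rank 1, so positive rank alone does not keep the
      result nonempty. A last vertex of degree at most 1 carries no loop and has rank 0, against the
      assumption.\<close>
    have "verts G \<noteq> {x}"
      using graph_rank_singleton_le[OF less.prems(1) _ x(2)] less.prems(3) by auto
    then have ne: "verts ?G \<noteq> {}" using x(1) by (auto simp: del_vert_simps)
    have le: "graph_rank G \<le> graph_rank ?G"
      by (rule graph_rank_le_del_vert[OF less.prems(1) x])
    have "card (verts ?G) < card (verts G)"
      unfolding verts_del_vert using x(1) by (rule card_Diff1_less[OF finite_verts])
    moreover have "graph_rank ?G > 0" using le less.prems(3) by linarith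
    ultimately obtain D where D: "subgraph D ?G" "verts D \<noteq> {}"
      "\<forall>y \<in> verts D. 2 \<le> link_degree D y" "graph_rank ?G \<le> graph_rank D"
      using less.hyps[OF _ fin_digraph_del_vert ne] by blast
    have "subgraph D G" using D(1) subgraph_del_vert by (rule subgraph_trans)
    moreover have "graph_rank G \<le> graph_rank D" using le D(4) by linarith
    ultimately show ?thesis using D(2,3) by blast
  qed
qed

section \<open>Subgraphs of connected graphs\<close>

lemma exists_crossing_arc:
  assumes "Digraph_Component.connected G" "S \<subseteq> verts G" "S \<noteq> {}" "S \<noteq> verts G"
  shows "\<exists>e \<in> arcs G. (tail G e \<in> S) \<noteq> (head G e \<in> S)"
proof (rule ccontr)
  assume no: "\<not> ?thesis"
  obtain u y where uy: "u \<in> S" "y \<in> verts G" "y \<notin> S" using assms by blast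
  have "u \<rightarrow>\<^sup>*\<^bsub>with_proj (mk_symmetric G)\<^esub> y"
    using assms uy unfolding Digraph_Component.connected_def strongly_connected_def by auto
  then have "(u, y) \<in> rtrancl_on (verts G) (parcs (mk_symmetric G))"
    by (simp add: reachable_def)
  \<comment> \<open>Without a crossing edge, \<open>S\<close> cannot be left along an edge in either
    direction.\<close>
  then have "u \<in> S \<longrightarrow> y \<in> S"
    by induction (use no in \<open>auto simp: parcs_mk_symmetric\<close>)
  then show False using uy by blast
qed

text \<open>As long as vertices are missing, some edge of \<open>G\<close> joins \<open>G'\<close>
  to a new vertex, and adding both preserves the rank. Once all vertices are present, the remaining
  edges can only increase it. \<open>G'\<close> itself may be disconnected.\<close>

lemma graph_rank_subgraph_le:
  assumes "fin_digraph G" "Digraph_Component.connected G" "subgraph G' G" "verts G' \<noteq> {}"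
  shows "graph_rank G' \<le> graph_rank G"
  using assms(3,4)
proof (induction "card (verts G - verts G')" arbitrary: G' rule: less_induct)
  case less
  interpret G: fin_digraph G by (rule assms)
  interpret G': fin_digraph G' by (rule G.fin_digraph_subgraph[OF less.prems(1)])
  have sub: "verts G' \<subseteq> verts G" "arcs G' \<subseteq> arcs G" "tail G' = tail G" "head G' = head G"
    using less.prems(1) by (auto simp: subgraph_def compatible_def)
  show ?case
  proof (cases "verts G' = verts G")
    case True
    then show ?thesis using sub(2) by (simp add: graph_rank_def card_mono)
  next
    case False
    from exists_crossing_arc[OF assms(2) sub(1) less.prems(2) False]
    obtain e where e: "e \<in> arcs G" "(tail G e \<in> verts G') \<noteq> (head G e \<in> verts G')" by blast
    define z where "z = (if tail G e \<in> verts G' then head G e else tail G e)"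
    let ?G = "G'.add_arc e"
    have z: "z \<in> verts G" "z \<notin> verts G'" and verts: "verts ?G = insert z (verts G')"
      using e by (auto simp: z_def G'.verts_add_arc_conv sub)
    \<comment> \<open>Exactly one edge and one vertex are new, so their contributions
      cancel.\<close>
    have "e \<notin> arcs G'" using e(2) G'.wellformed sub by metis
    then have rank: "graph_rank ?G = graph_rank G'"
      using z by (simp add: graph_rank_def verts)
    have "subgraph ?G G"
      using sub e z G.wf_digraph G'.wf_digraph_add_arc[of e]
      by (auto simp: subgraph_def compatible_def verts)
    moreover have "card (verts G - verts ?G) < card (verts G - verts G')"
      using z by (intro psubset_card_mono) (auto simp: verts)
    ultimately show ?thesis using less.hyps[of ?G] rank verts by simp
  qed
qed

lemma graph_rank_nonneg:
  assumes "fin_digraph G" "Digraph_Component.connected G"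
  shows "0 \<le> graph_rank G"
proof -
  interpret fin_digraph G by fact
  obtain x where "x \<in> verts G"
    using assms(2) by (auto simp: Digraph_Component.connected_def strongly_connected_def)
  \<comment> \<open>A single point is a subgraph of rank 0.\<close>
  let ?P = "\<lparr>verts = {x}, arcs = {}, tail = tail G, head = head G\<rparr>"
  have "subgraph ?P G"
    using \<open>x \<in> verts G\<close> wf_digraph by (auto simp: subgraph_def compatible_def wf_digraph_def)
  from graph_rank_subgraph_le[OF assms this] show ?thesis by (simp add: graph_rank_def)
qed

section \<open>Fiber products\<close>

lemma fin_digraph_fiber_product:
  assumes "fin_digraph H" "fin_digraph K"
  shows "fin_digraph (fiber_product lH H lK K)"
proof -
  interpret H: fin_digraph H by fact
  interpret K: fin_digraph K by fact
  have "finite {(e1, e2) \<in> arcs H \<times> arcs K. on_arcs lH e1 = on_arcs lK e2}"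
    by (rule finite_subset[of _ "arcs H \<times> arcs K"]) auto
  then show ?thesis
    by unfold_locales (auto simp: fiber_product_def)
qed

lemma subgraph_component:
  assumes "fin_digraph G"
  shows "subgraph (component G x) G"
proof -
  interpret fin_digraph G by fact
  interpret S: pair_wf_digraph "mk_symmetric G" ..
  have "{y. reachable (with_proj (mk_symmetric G)) x y} \<subseteq> verts G"
    using S.reachable_in_verts by auto
  then show ?thesis
    unfolding component_def using induced_induce induced_imp_subgraph by blast
qed

lemma component_nonempty:
  assumes "x \<in> verts G"
  shows "x \<in> verts (component G x)"
  using assms by (simp add: component_def reachable_def)

text \<open>Incidence is inherited from \<open>K\<close>, so that the image of a graph lying over
  \<open>K\<close> becomes a subgraph of \<open>K\<close>.\<close>

definition image_graph :: "('a \<Rightarrow> 'c) \<Rightarrow> ('e \<Rightarrow> 'g) \<Rightarrow> ('a, 'e) pre_digraph \<Rightarrow>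
    ('c, 'g) pre_digraph \<Rightarrow> ('c, 'g) pre_digraph" where
  "image_graph f g D K =
     \<lparr>verts = f ` verts D, arcs = g ` arcs D, tail = tail K, head = head K\<rparr>"

section \<open>Projecting a subgraph of the fiber product to \<open>K\<close>\<close>

context
  fixes lH :: "('a, 'e, 'b, 'f) graph_map" and H :: "('a, 'e) pre_digraph"
    and lK :: "('c, 'g, 'b, 'f) graph_map" and K :: "('c, 'g) pre_digraph"
    and B :: "('b, 'f) pre_digraph" and D :: "('a \<times> 'c, 'e \<times> 'g) pre_digraph"
  assumes fin_H: "fin_digraph H" and fin_K: "fin_digraph K"
    and imm_H: "immersion lH H B" and imm_K: "immersion lK K B"
    and sub_D: "subgraph D (fiber_product lH H lK K)"
begin

lemma fiber_subgraph_facts: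
  shows "verts D \<subseteq> verts H \<times> verts K"
    and "e \<in> arcs D \<Longrightarrow> fst e \<in> arcs H \<and> snd e \<in> arcs K \<and> on_arcs lH (fst e) = on_arcs lK (snd e)"
    and "tail D e = (tail H (fst e), tail K (snd e))"
    and "head D e = (head H (fst e), head K (snd e))"
  using sub_D by (auto simp: subgraph_def compatible_def fiber_product_def map_prod_def split_beta
      dest: sym)

lemma fin_D: "fin_digraph D"
  using fin_digraph.fin_digraph_subgraph[OF fin_digraph_fiber_product[OF fin_H fin_K] sub_D] .

abbreviation "K' \<equiv> image_graph snd snd D K"

lemma subgraph_projection: "subgraph K' K"
proof -
  interpret D: fin_digraph D by (rule fin_D)
  have "tail K (snd e) \<in> snd ` verts D \<and> head K (snd e) \<in> snd ` verts D" if "e \<in> arcs D" for e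
    using D.wellformed[OF that] by (force simp: fiber_subgraph_facts(3,4))
  then have "wf_digraph K'" by unfold_locales (auto simp: image_graph_def)
  then show ?thesis
    using fiber_subgraph_facts(1,2) fin_digraph.axioms(1)[OF fin_K]
    by (auto simp: subgraph_def compatible_def image_graph_def)
qed

text \<open>Links at different vertices of \<open>D\<close> become comparable once they are pushed
  down to \<open>B\<close>.\<close>

abbreviation base_link :: "'a \<times> 'c \<Rightarrow> ('f + 'f) set" where
  "base_link x \<equiv> on_link lH ` map_sum fst fst ` link D x"

lemma link_fst: "map_sum fst fst ` link D x \<subseteq> link H (fst x)"
  using fiber_subgraph_facts(2,3,4) by (force simp: link_def out_arcs_def in_arcs_def)

lemma link_snd: "map_sum snd snd ` link D x \<subseteq> link K' (snd x)"
  using fiber_subgraph_facts(2,3,4) by (force simp: link_def out_arcs_def in_arcs_def image_graph_def)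

lemma on_link_fst_snd:
  assumes "d \<in> link D x"
  shows "on_link lH (map_sum fst fst d) = on_link lK (map_sum snd snd d)"
  using assms fiber_subgraph_facts(2) by (cases d) (auto simp: on_link_def link_def)

lemma base_link_snd: "base_link x = on_link lK ` map_sum snd snd ` link D x"
  unfolding image_image by (rule image_cong[OF refl on_link_fst_snd])

text \<open>An element of the link in \<open>D\<close> is determined by its two projections, and its
  image in \<open>B\<close> determines both of them because \<open>lH\<close> and \<open>lK\<close>
  are injective on links.\<close>

lemma card_base_link:
  assumes "x \<in> verts D"
  shows "card (base_link x) = link_degree D x"
proof -
  have x: "fst x \<in> verts H" "snd x \<in> verts K" using assms fiber_subgraph_facts(1) by auto
  have "inj_on (on_link lH \<circ> map_sum fst fst) (link D x)"
  proof (rule inj_onI)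
    fix d d' assume d: "d \<in> link D x" "d' \<in> link D x"
      and eq: "(on_link lH \<circ> map_sum fst fst) d = (on_link lH \<circ> map_sum fst fst) d'"
    have "inj_on (on_link lH) (link H (fst x))" "inj_on (on_link lK) (link K (snd x))"
      using imm_H imm_K x by (auto simp: immersion_def)
    moreover have "map_sum snd snd ` link D x \<subseteq> link K (snd x)"
      using link_snd link_subgraph_mono[OF subgraph_projection] by blast
    ultimately have "map_sum fst fst d = map_sum fst fst d'" "map_sum snd snd d = map_sum snd snd d'"
      using d eq link_fst[of x] on_link_fst_snd[of _ x] by (auto simp: inj_on_def image_subset_iff)
    then show "d = d'" by (cases d; cases d') (auto simp: prod_eq_iff)
  qed
  from card_image[OF this] show ?thesis by (simp only: link_degree_def image_comp)
qed

text \<open>The images in \<open>B\<close> of the links over \<open>k\<close> all lie in the image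
  of the link of \<open>k\<close>, and inertness bounds their overlaps by 2. This is the same 2 that
  is subtracted from each degree in the rank formula, so the bound on excesses applies with
  \<open>m = 2\<close>.\<close>

lemma sum_fiber_excess_le:
  assumes "card (verts B) = 1" "highly_inert lH lH H B"
    and deg: "\<And>x. x \<in> verts D \<Longrightarrow> 2 \<le> link_degree D x"
    and k: "k \<in> verts K'"
  shows "(\<Sum>x\<in>{x \<in> verts D. snd x = k}. int (link_degree D x) - 2) \<le> int (link_degree K' k) - 2"
proof -
  interpret D: fin_digraph D by (rule fin_D)
  interpret H: fin_digraph H by (rule fin_H)
  have fin_K': "fin_digraph K'"
    using fin_digraph.fin_digraph_subgraph[OF fin_K subgraph_projection] .
  let ?S = "{x \<in> verts D. snd x = k}"
  let ?L = "on_link lK ` link K' k"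
  define T where "T = {x \<in> ?S. 3 \<le> link_degree D x}"
  have fin_L: "finite ?L" and card_L: "card ?L \<le> link_degree K' k"
    using finite_link[OF fin_K'] by (auto simp: link_degree_def card_image_le)
  have sub_L: "base_link x \<subseteq> ?L" if "x \<in> ?S" for x
    using that link_snd[of x] unfolding base_link_snd by blast
  \<comment> \<open>Vertices of degree 2 contribute nothing.\<close>
  have "(\<Sum>x\<in>?S. int (link_degree D x) - 2) = (\<Sum>x\<in>T. int (link_degree D x) - 2)"
    by (rule sum.mono_neutral_right) (use deg in \<open>force simp: T_def\<close>)+
  also have "\<dots> \<le> int (card ?L) - 2"
  proof (cases "T = {}")
    case True
    \<comment> \<open>The left side is 0 here; any vertex over \<open>k\<close> has degree at least
      2 and makes the right side nonnegative.\<close>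
    obtain x where x: "x \<in> ?S" using k by (auto simp: image_graph_def)
    have "2 \<le> card (base_link x)" using x deg card_base_link by auto
    also have "\<dots> \<le> card ?L" using sub_L[OF x] fin_L by (rule card_mono[rotated])
    finally show ?thesis using True by simp
  next
    case False
    obtain b where b: "verts B = {b}" using assms(1) card_1_singletonE by blast
    \<comment> \<open>Over the only vertex of \<open>B\<close>, high inertness concerns all of
      \<open>H\<close> at once.\<close>
    have all: "{h \<in> verts H. on_verts lH h = b} = verts H"
      using imm_H b by (auto simp: immersion_def graph_morphism_def)
    have inert: "(\<Sum>w \<in> branching H (verts H) - {h}.
        card (on_link lH ` link H h \<inter> on_link lH ` link H w)) \<le> 2"
      if "h \<in> branching H (verts H)" for h
      using assms(2) b all that by (auto simp: highly_inert_def inert_set_def)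
    have sub_H: "base_link x \<subseteq> on_link lH ` link H (fst x)" for x
      using link_fst by blast
    have branch: "fst x \<in> branching H (verts H)" if "x \<in> T" for x
    proof -
      have "3 \<le> card (base_link x)" using that card_base_link by (auto simp: T_def)
      also have "\<dots> \<le> card (on_link lH ` link H (fst x))"
        using sub_H finite_link[OF fin_H] by (intro card_mono) blast+
      also have "\<dots> \<le> card (link H (fst x))"
        using finite_link[OF fin_H] by (rule card_image_le)
      finally show ?thesis
        using that fiber_subgraph_facts(1) by (auto simp: branching_def link_degree_def T_def)
    qed
    have "(\<Sum>x\<in>T. int (card (base_link x)) - int 2) \<le> int (card ?L) - int 2"
    proof (rule sum_card_excess_le)
      fix x assume x: "x \<in> T"
      \<comment> \<open>All vertices in \<open>T\<close> have second coordinate \<open>k\<close>.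
        Hence distinct ones lie over distinct vertices of \<open>H\<close>, and their overlaps are
        bounded by distinct terms of the inertness sum.\<close>
      have inj: "inj_on fst T" by (auto simp: inj_on_def T_def)
      have "(\<Sum>y \<in> T - {x}. card (base_link x \<inter> base_link y))
          \<le> (\<Sum>y \<in> T - {x}. card (on_link lH ` link H (fst x) \<inter> on_link lH ` link H (fst y)))"
        using sub_H finite_link[OF fin_H] by (intro sum_mono card_mono) blast+
      also have "\<dots> = (\<Sum>w \<in> fst ` (T - {x}).
          card (on_link lH ` link H (fst x) \<inter> on_link lH ` link H w))"
        using inj by (subst sum.reindex) (auto simp: inj_on_def)
      also have "\<dots> \<le> (\<Sum>w \<in> branching H (verts H) - {fst x}.
          card (on_link lH ` link H (fst x) \<inter> on_link lH ` link H w))"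
        using branch inj x by (intro sum_mono2) (auto simp: branching_def dest: inj_onD)
      also have "\<dots> \<le> 2" by (rule inert[OF branch[OF x]])
      finally show "(\<Sum>y \<in> T - {x}. card (base_link x \<inter> base_link y)) \<le> 2" .
    qed (use False fin_L sub_L in \<open>auto simp: T_def\<close>)
    moreover have "card (base_link x) = link_degree D x" if "x \<in> T" for x
      using that card_base_link by (simp add: T_def)
    ultimately show ?thesis by simp
  qed
  finally show ?thesis using card_L by linarith
qed

lemma graph_rank_le_projection:
  assumes "card (verts B) = 1" "highly_inert lH lH H B"
    and "\<And>x. x \<in> verts D \<Longrightarrow> 2 \<le> link_degree D x"
  shows "graph_rank D \<le> graph_rank K'"
proof -
  interpret D: fin_digraph D by (rule fin_D)
  have fin_K': "fin_digraph K'"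
    using fin_digraph.fin_digraph_subgraph[OF fin_K subgraph_projection] .
  have "(\<Sum>x\<in>verts D. int (link_degree D x) - 2)
      = (\<Sum>k\<in>verts K'. \<Sum>x\<in>{x \<in> verts D. snd x = k}. int (link_degree D x) - 2)"
    by (rule sum.group[symmetric]) (auto simp: image_graph_def)
  also have "\<dots> \<le> (\<Sum>k\<in>verts K'. int (link_degree K' k) - 2)"
    by (intro sum_mono sum_fiber_excess_le assms)
  finally show ?thesis
    using graph_rank_conv_degree[OF fin_D] graph_rank_conv_degree[OF fin_K'] by linarith
qed

end

theorem proposition3p7:
  fixes n :: nat
    and B :: "('b, 'f) pre_digraph"
    and H :: "('a, 'e) pre_digraph"
    and v :: 'a
    and l :: "('a, 'e, 'b, 'f) graph_map"
  assumes "bouquet n B"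
    and "fin_digraph H" and "Digraph_Component.connected H" and "v \<in> verts H"
    and "immersion l H B"
    and "highly_inert l l H B"
  shows "inert_immersion TYPE('c) TYPE('g) l H v B"
proof -
  have "graph_rank (component (fiber_product l H lK K) (v, w)) \<le> graph_rank K"
    if K: "fin_digraph K" "Digraph_Component.connected K" and w: "w \<in> verts K"
      and imm: "immersion lK K B"
    for K :: "('c, 'g) pre_digraph" and w lK
  \<comment> \<open>Pruning needs positive rank; otherwise the rank of the connected graph
    \<open>K\<close> is large enough by being nonnegative.\<close>
  proof (cases "graph_rank (component (fiber_product l H lK K) (v, w)) \<le> 0")
    case True
    then show ?thesis using graph_rank_nonneg[OF K] by linarith
  next
    case False
    let ?F = "fiber_product l H lK K"
    let ?C = "component ?F (v, w)"
    have fin_F: "fin_digraph ?F" by (rule fin_digraph_fiber_product[OF assms(2) K(1)])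
    have sub_C: "subgraph ?C ?F" by (rule subgraph_component[OF fin_F])
    have "(v, w) \<in> verts ?F" using assms(4) w by (simp add: fiber_product_def)
    then have "verts ?C \<noteq> {}" using component_nonempty by fast
    with False obtain D where D: "subgraph D ?C" "verts D \<noteq> {}"
      "\<forall>x \<in> verts D. 2 \<le> link_degree D x" "graph_rank ?C \<le> graph_rank D"
      using exists_min_degree_2_subgraph[OF fin_digraph.fin_digraph_subgraph[OF fin_F sub_C]]
      by auto
    have sub_D: "subgraph D ?F" using D(1) sub_C by (rule subgraph_trans)
    let ?K' = "image_graph snd snd D K"
    have "graph_rank D \<le> graph_rank ?K'"
      using graph_rank_le_projection[OF assms(2) K(1) assms(5) imm sub_D _ assms(6)] D(3) assms(1)
      by (auto simp: bouquet_def)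
    also have "\<dots> \<le> graph_rank K"
      using D(2) by (intro graph_rank_subgraph_le K subgraph_projection[OF assms(2) K(1) assms(5) imm sub_D])
        (simp add: image_graph_def)
    finally show ?thesis using D(4) by linarith
  qed
  then show ?thesis unfolding inert_immersion_def by blast
qed

end
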